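(* Let $A$ be a finite set of positive integers, and denote its maximum by $d$. For all $n$ such that $\mathfrak{S}_n^{(A)}$ is nonempty, let $\sigma_n$ be a random permutation which has the uniform distribution on $\mathfrak{S}_n^{(A)}$. Then for all $l\in A$, as $n$ goes to infinity in such a way that $\mathfrak{S}_n^{(A)}$ is nonempty, $\dfrac{N_l(\sigma_n)}{n^{l/d}}$ converges in all $L^p$ spaces ($p\in[1,+\infty)$) to $1/l$; that is, for every $p\in[1,+\infty)$, $$\mathbb{E}\left[\left|\frac{N_l(\sigma_n)}{n^{l/d}}-\frac1l\right|^p\right]\longrightarrow 0.$$
   Context: For $A$ a set of positive integers, $\mathfrak{S}_n^{(A)}$ is the set of permutations of $\{1,\ldots,n\}$ all of whose cycles have length in $A$ (fixed points count as cycles of length $1$). For a permutation $\sigma$ and $l$ a positive integer, $N_l(\sigma)$ is the number of cycles of length $l$ in the decomposition of $\sigma$ as a product of cycles with disjoint supports. *)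

theory Defs
  imports
    "HOL-Probability.Probability"
    "HOL-Combinatorics.Permutations"
    "HOL-Combinatorics.Orbits"
begin

text \<open>
  A cycle of a permutation \<open>\<sigma>\<close> of \<open>{1..n}\<close> is represented by the set of elements it moves around,
  so its length is the cardinality of that set. A fixed point \<open>x\<close> gives the cycle \<open>{x}\<close> of
  length 1, because \<open>orbit \<sigma> x = {x}\<close> in that case. Points outside \<open>{1..n}\<close> are fixed by \<open>\<sigma>\<close>
  but must not be counted, hence the restriction \<open>C \<subseteq> {1..n}\<close>.
\<close>

definition cycles :: "nat \<Rightarrow> (nat \<Rightarrow> nat) \<Rightarrow> nat set set" where
  "cycles n \<sigma> = {C. C \<subseteq> {1..n} \<and> cyclic_on \<sigma> C}"

definition perms_with_lengths :: "nat set \<Rightarrow> nat \<Rightarrow> (nat \<Rightarrow> nat) set" where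
  "perms_with_lengths A n = {\<sigma>. \<sigma> permutes {1..n} \<and> (\<forall>C\<in>cycles n \<sigma>. card C \<in> A)}"

definition num_cycles :: "nat \<Rightarrow> nat \<Rightarrow> (nat \<Rightarrow> nat) \<Rightarrow> nat" where
  "num_cycles n l \<sigma> = card {C \<in> cycles n \<sigma>. card C = l}"

lemma finite_perms_with_lengths: "finite (perms_with_lengths A n)"
  by (rule finite_subset[OF _ finite_permutations[of "{1..n}"]])
     (auto simp: perms_with_lengths_def)

end

theory Submission
  imports Defs "HOL-Combinatorics.Cycles" "HOL-Real_Asymp.Real_Asymp"
begin

text \<open>
  Write \<open>(N)\<^sub>m\<close> for the falling factorial and \<open>d\<close> for the maximum of \<open>A\<close>. Removing \<open>m\<close> marked
  \<open>l\<close>-cycles, each with a marked point, shows that \<open>l\<^sup>m E (N\<^sub>l)\<^sub>m\<close> depends only on the product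
  \<open>l * m\<close> (and on \<open>n\<close> and \<open>A\<close>), so that
  \<open>l^(d * m) * E (N\<^sub>l)_(d * m) = d^(l * m) * E (N\<^sub>d)_(l * m)\<close>.
  As \<open>d * N\<^sub>d \<le> n\<close>, the right-hand side is at most \<open>n^(l * m)\<close>. Hence all moments of
  \<open>X\<^sub>l = N\<^sub>l / n^(l / d)\<close> are bounded, and \<open>E N\<^sub>l / n\<close> tends to \<open>0\<close> for \<open>l < d\<close>. Since \<open>\<Sum>l\<in>A. l * N\<^sub>l = n\<close>,
  the variable \<open>d * N\<^sub>d / n\<close> tends to \<open>1\<close> in all moments. Feeding this back into the identity gives
  \<open>E X\<^sub>l^(d * m) \<longlongrightarrow> (1 / l)^(d * m)\<close> for all \<open>m\<close>, so all moments of \<open>X\<^sub>l^d - (1 / l)^d\<close> tend to \<open>0\<close>, and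
  \<open>\<bar>X\<^sub>l - 1 / l\<bar>^d \<le> \<bar>X\<^sub>l^d - (1 / l)^d\<bar>\<close>.
\<close>

section \<open>Cycles over an arbitrary ground set\<close>

text \<open>The ground set is arbitrary because removing a cycle from a permutation of
  \<open>{1..n}\<close> leaves a permutation of a set that need not be an initial segment.\<close>

definition cycles_on :: "'a set \<Rightarrow> ('a \<Rightarrow> 'a) \<Rightarrow> 'a set set" where
  "cycles_on S \<sigma> = {C. C \<subseteq> S \<and> cyclic_on \<sigma> C}"

definition perms_on :: "nat set \<Rightarrow> 'a set \<Rightarrow> ('a \<Rightarrow> 'a) set" where
  "perms_on A S = {\<sigma>. \<sigma> permutes S \<and> (\<forall>C\<in>cycles_on S \<sigma>. card C \<in> A)}"

definition num_cycles_on :: "'a set \<Rightarrow> nat \<Rightarrow> ('a \<Rightarrow> 'a) \<Rightarrow> nat" where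
  "num_cycles_on S l \<sigma> = card {C \<in> cycles_on S \<sigma>. card C = l}"

text \<open>Lists rather than sets: a list records a cycle together with its marked point, the head,
  and the order in which the cycle is traversed.\<close>

definition dlists :: "nat \<Rightarrow> 'a set \<Rightarrow> 'a list set" where
  "dlists k S = {xs. distinct xs \<and> length xs = k \<and> set xs \<subseteq> S}"

text \<open>The subtraction is truncated, so this is the falling factorial, which vanishes for \<open>N < m\<close>.\<close>
definition ffact :: "nat \<Rightarrow> nat \<Rightarrow> nat" where
  "ffact N m = (\<Prod>i<m. N - i)"

lemma ffact_0 [simp]: "ffact N 0 = 1"
  by (simp add: ffact_def)

lemma ffact_Suc: "ffact N (Suc m) = ffact N m * (N - m)"
  by (simp add: ffact_def)

lemma ffact_Suc_left: "ffact N (Suc m) = N * ffact (N - 1) m"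
  by (simp only: ffact_def prod.lessThan_Suc_shift) simp

lemma finite_cycles_on: "finite S \<Longrightarrow> finite (cycles_on S \<sigma>)"
  by (auto simp: cycles_on_def intro: finite_subset[of _ "Pow S"])

lemma finite_perms_on: "finite S \<Longrightarrow> finite (perms_on A S)"
  by (rule finite_subset[OF _ finite_permutations[of S]]) (auto simp: perms_on_def)

lemma finite_dlists: "finite S \<Longrightarrow> finite (dlists k S)"
  by (rule finite_subset[OF _ finite_lists_length_eq[of S k]]) (auto simp: dlists_def)

lemma orbit_mem_cycles_on:
  assumes "\<sigma> permutes S" "finite S" "x \<in> S"
  shows "orbit \<sigma> x \<in> cycles_on S \<sigma>" "x \<in> orbit \<sigma> x"
  using assms
  by (auto simp: cycles_on_def cyclic_on_orbit permutation_permutes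
      dest: permutes_orbit_subset intro!: permutation_self_in_orbit)

section \<open>Removing a marked cycle\<close>

text \<open>A cycle is the orbit of each of its points, so a cycle of \<open>\<sigma>\<close>
  meeting \<open>C\<close> is \<open>C\<close> itself. The others lie in \<open>S - C\<close>, where
  \<open>\<sigma>\<close> and \<open>\<tau>\<close> agree, and being cyclic depends only on the
  values there. This serves both to cut a cycle off and to glue one on.\<close>

lemma cycles_on_split:
  assumes "cyclic_on \<sigma> C" "C \<subseteq> S" "\<And>y. y \<in> S - C \<Longrightarrow> \<sigma> y = \<tau> y"
  shows "cycles_on S \<sigma> = insert C (cycles_on (S - C) \<tau>)" "C \<notin> cycles_on (S - C) \<tau>"
proof -
  have eq: "cyclic_on \<sigma> D \<longleftrightarrow> cyclic_on \<tau> D" if "D \<subseteq> S - C" for D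
    using that assms(3) by (intro cyclic_cong) auto
  have "D = C" if "cyclic_on \<sigma> D" "y \<in> D" "y \<in> C" for D y
    using orbit_cyclic_eq3[OF that(1,2)] orbit_cyclic_eq3[OF assms(1) that(3)] by simp
  then have dj: "D = C \<or> D \<subseteq> S - C" if "cyclic_on \<sigma> D" "D \<subseteq> S" for D
    using that by blast
  show "cycles_on S \<sigma> = insert C (cycles_on (S - C) \<tau>)"
  proof (intro set_eqI iffI)
    fix D assume "D \<in> cycles_on S \<sigma>"
    then show "D \<in> insert C (cycles_on (S - C) \<tau>)"
      using dj[of D] eq[of D] by (auto simp: cycles_on_def)
  next
    fix D assume "D \<in> insert C (cycles_on (S - C) \<tau>)"
    then show "D \<in> cycles_on S \<sigma>"
      using assms(1,2) eq[of D] by (auto simp: cycles_on_def)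
  qed
  show "C \<notin> cycles_on (S - C) \<tau>"
    using assms(1) by (auto simp: cycles_on_def cyclic_on_alldef)
qed

lemma num_cycles_on_split:
  assumes "finite S" "cyclic_on \<sigma> C" "C \<subseteq> S" "\<And>y. y \<in> S - C \<Longrightarrow> \<sigma> y = \<tau> y" "card C = l"
  shows "num_cycles_on S l \<sigma> = Suc (num_cycles_on (S - C) l \<tau>)"
proof -
  note s = cycles_on_split[where \<sigma> = \<sigma> and C = C and S = S and \<tau> = \<tau>, OF assms(2-4)]
  have "{D \<in> cycles_on S \<sigma>. card D = l} = insert C {D \<in> cycles_on (S - C) \<tau>. card D = l}"
    using s(1) assms(5) by auto
  moreover have "finite (cycles_on (S - C) \<tau>)"
    using assms(1) by (simp add: finite_cycles_on)
  ultimately show ?thesis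
    using s(2) by (simp add: num_cycles_on_def)
qed

section \<open>Counting points by the length of their cycle\<close>

lemma cycles_on_disjoint:
  assumes "C \<in> cycles_on S \<sigma>" "D \<in> cycles_on S \<sigma>" "C \<noteq> D"
  shows "C \<inter> D = {}"
proof (rule ccontr)
  assume "C \<inter> D \<noteq> {}"
  then obtain y where "y \<in> C" "y \<in> D" by auto
  then show False
    using orbit_cyclic_eq3[of \<sigma> C y] orbit_cyclic_eq3[of \<sigma> D y] assms by (auto simp: cycles_on_def)
qed

text \<open>These points form the disjoint union of the \<open>l\<close>-cycles. This turns a factor
  \<open>l * num_cycles_on S l \<sigma>\<close> into a choice of a marked point.\<close>

lemma card_points_in_cycles:
  assumes "\<sigma> permutes S" "finite S"
  shows "card {x \<in> S. card (orbit \<sigma> x) = l} = l * num_cycles_on S l \<sigma>"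
proof -
  let ?K = "{C \<in> cycles_on S \<sigma>. card C = l}"
  have "{x \<in> S. card (orbit \<sigma> x) = l} = \<Union>?K"
  proof (intro equalityI subsetI)
    fix x assume "x \<in> {x \<in> S. card (orbit \<sigma> x) = l}"
    then show "x \<in> \<Union>?K" using orbit_mem_cycles_on[OF assms, of x] by auto
  next
    fix x assume "x \<in> \<Union>?K"
    then obtain C where "x \<in> C" "C \<in> cycles_on S \<sigma>" "card C = l" by auto
    then show "x \<in> {x \<in> S. card (orbit \<sigma> x) = l}"
      using orbit_cyclic_eq3[of \<sigma> C x] by (auto simp: cycles_on_def)
  qed
  also have "card \<dots> = (\<Sum>C\<in>?K. card C)"
    using assms cycles_on_disjoint[of _ S \<sigma>]
    by (intro card_Union_disjoint) (auto simp: pairwise_def disjnt_def cycles_on_def finite_subset)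
  also have "\<dots> = l * num_cycles_on S l \<sigma>"
    by (simp add: num_cycles_on_def)
  finally show ?thesis .
qed

lemma sum_num_cycles_on:
  assumes "\<sigma> \<in> perms_on A S" "finite S" "finite A"
  shows "(\<Sum>k\<in>A. k * num_cycles_on S k \<sigma>) = card S"
proof -
  have p: "\<sigma> permutes S" using assms(1) by (simp add: perms_on_def)
  have "card S = (\<Sum>x\<in>S. 1)" by simp
  also have "\<dots> = (\<Sum>k\<in>A. \<Sum>x\<in>{x \<in> S. card (orbit \<sigma> x) = k}. 1)"
    using orbit_mem_cycles_on(1)[OF p assms(2)] assms
    by (intro sum.group[symmetric]) (auto simp: perms_on_def)
  also have "\<dots> = (\<Sum>k\<in>A. k * num_cycles_on S k \<sigma>)"
    using card_points_in_cycles[OF p assms(2)] by simp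
  finally show ?thesis by simp
qed

section \<open>Cycles as lists\<close>

text \<open>The first return time \<open>funpow_dist1 \<sigma> x x\<close> is the size of the orbit,
  so the first \<open>l\<close> iterates enumerate it once and the next one closes it.\<close>

lemma orbit_list:
  assumes "\<sigma> permutes S" "finite S" "x \<in> S" "card (orbit \<sigma> x) = l"
  defines "xs \<equiv> map (\<lambda>i. (\<sigma> ^^ i) x) [0..<l]"
  shows "distinct xs" "set xs = orbit \<sigma> x" "(\<sigma> ^^ l) x = x" "0 < l"
proof -
  note x = orbit_mem_cycles_on(2)[OF assms(1-3)]
  note o = orbit_conv_funpow_dist1[OF x]
  note i = inj_on_funpow_dist1[OF x]
  have l: "l = funpow_dist1 \<sigma> x x"
    using assms(4) card_image[OF i] o by simp
  show "distinct xs" unfolding xs_def distinct_map l using i by (simp only: set_upt distinct_upt)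
  show "set xs = orbit \<sigma> x" unfolding xs_def set_map set_upt l by (rule o[symmetric])
  show "(\<sigma> ^^ l) x = x" using funpow_dist1_prop[OF x] l by simp
  show "0 < l" using l by simp
qed

text \<open>Applying the cycle to all entries of \<open>xs\<close> rotates the list by one
  place.\<close>

lemma cycle_of_list_funpow:
  assumes "distinct xs" "xs \<noteq> []"
  shows "(cycle_of_list xs ^^ i) (hd xs) = xs ! (i mod length xs)"
proof -
  have "(cycle_of_list xs ^^ i) (hd xs) = map (cycle_of_list xs ^^ i) xs ! 0"
    using assms(2) by (simp add: hd_conv_nth)
  also have "\<dots> = rotate i xs ! 0"
    using cyclic_rotation[OF assms(1)] by simp
  also have "\<dots> = xs ! (i mod length xs)"
    using assms(2) by (simp add: nth_rotate)
  finally show ?thesis .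
qed

lemma orbit_cycle_of_list:
  assumes "distinct xs" "xs \<noteq> []"
  shows "orbit (cycle_of_list xs) (hd xs) = set xs"
proof -
  have "orbit (cycle_of_list xs) (hd xs) = {(cycle_of_list xs ^^ m) (hd xs) | m. m < length xs}"
    using cycle_of_list_funpow[OF assms, of "length xs"] assms(2)
    by (intro orbit_altdef_bounded) (simp_all add: hd_conv_nth)
  also have "\<dots> = set xs"
    using assms by (auto simp: cycle_of_list_funpow set_conv_nth) (metis mod_less)
  finally show ?thesis .
qed

text \<open>A permutation together with a point on an \<open>l\<close>-cycle amounts to the list enumerating this cycle
  from that point, together with a permutation of the complement.\<close>
lemma marked_cycle_bij:
  assumes "finite S" "l \<in> A" "0 < l"
  shows "bij_betw (\<lambda>(\<sigma>, x). (map (\<lambda>i. (\<sigma> ^^ i) x) [0..<l], perm_restrict \<sigma> (S - orbit \<sigma> x)))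
     (SIGMA \<sigma>:perms_on A S. {x \<in> S. card (orbit \<sigma> x) = l})
     (SIGMA xs:dlists l S. perms_on A (S - set xs))"
    (is "bij_betw ?f ?D ?R")
  unfolding bij_betw_def
proof (intro conjI inj_onI equalityI subsetI)
  fix u v assume u: "u \<in> ?D" and v: "v \<in> ?D" and uv: "?f u = ?f v"
  obtain \<sigma> x \<rho> y where uv': "u = (\<sigma>, x)" "v = (\<rho>, y)" by (cases u, cases v)
  have s: "\<sigma> permutes S" "x \<in> S" "card (orbit \<sigma> x) = l" and r: "\<rho> permutes S" "y \<in> S" "card (orbit \<rho> y) = l"
    using u v unfolding uv' by (auto simp: perms_on_def)
  note os = orbit_list[OF s(1) assms(1) s(2,3)] and orr = orbit_list[OF r(1) assms(1) r(2,3)]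
  have pow: "(\<sigma> ^^ i) x = (\<rho> ^^ i) y" if "i < l" for i
    using uv that unfolding uv' by auto
  have xy: "x = y" using pow[of 0] assms(3) by simp
  have oo: "orbit \<sigma> x = orbit \<rho> y"
    using uv os(2) orr(2) unfolding uv' by simp
  \<comment> \<open>The case \<open>i = l\<close>, in which both walks are back at the start, is
    needed for the successor of the last entry of the list.\<close>
  have pow': "(\<sigma> ^^ i) x = (\<rho> ^^ i) y" if "i \<le> l" for i
    using pow[of i] os(3) orr(3) xy that by (cases "i = l") auto
  have "\<sigma> z = \<rho> z" for z
  proof (cases "z \<in> orbit \<sigma> x")
    case True
    then obtain i where i: "i < l" "z = (\<sigma> ^^ i) x" using os(2) by (auto simp flip: os(2))
    then show ?thesis using pow'[of i] pow'[of "Suc i"] by simp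
  next
    case False
    have "perm_restrict \<sigma> (S - orbit \<sigma> x) z = perm_restrict \<rho> (S - orbit \<rho> y) z"
      using uv unfolding uv' by simp
    then show ?thesis using False oo s(1) r(1) 
      by (auto simp: perm_restrict_def permutes_def split: if_splits)
  qed
  then show "u = v" using xy uv' by auto
next
  fix w assume "w \<in> ?f ` ?D"
  then obtain \<sigma> x where w: "w = ?f (\<sigma>, x)" and d: "\<sigma> \<in> perms_on A S" "x \<in> S" "card (orbit \<sigma> x) = l"
    by auto
  have s: "\<sigma> permutes S" using d by (simp add: perms_on_def)
  note os = orbit_list[OF s assms(1) d(2,3)]
  note c = orbit_mem_cycles_on[OF s assms(1) d(2)]
  have cc: "cyclic_on \<sigma> (orbit \<sigma> x)" "orbit \<sigma> x \<subseteq> S" using c by (auto simp: cycles_on_def)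
  have "cycles_on S \<sigma> = insert (orbit \<sigma> x) (cycles_on (S - orbit \<sigma> x) (perm_restrict \<sigma> (S - orbit \<sigma> x)))"
    by (rule cycles_on_split[OF cc]) (simp add: perm_restrict_def)
  then have "perm_restrict \<sigma> (S - orbit \<sigma> x) \<in> perms_on A (S - orbit \<sigma> x)"
    using d(1) perm_restrict_diff_cyclic[OF s cc(1)] by (auto simp: perms_on_def)
  then show "w \<in> ?R"
    using os(1,2) cc(2) unfolding w by (auto simp: dlists_def)
next
  fix w assume "w \<in> ?R"
  then obtain xs \<tau> where w: "w = (xs, \<tau>)" and xs: "distinct xs" "length xs = l" "set xs \<subseteq> S"
    and \<tau>: "\<tau> \<in> perms_on A (S - set xs)"
    by (auto simp: dlists_def)
  have ne: "xs \<noteq> []" using xs(2) assms(3) by auto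
  define c where "c = cycle_of_list xs"
  \<comment> \<open>The preimage: \<open>c\<close> and \<open>\<tau>\<close> have disjoint supports,
    so \<open>\<sigma>\<close> acts as \<open>c\<close> on \<open>set xs\<close> and as
    \<open>\<tau>\<close> on the rest; the marked point is \<open>hd xs\<close>.\<close>
  define \<sigma> where "\<sigma> = c \<circ> \<tau>"
  have t: "\<tau> permutes S - set xs" using \<tau> by (simp add: perms_on_def)
  have cp: "c permutes set xs" unfolding c_def by (rule cycle_permutes)
  have s: "\<sigma> permutes S"
    unfolding \<sigma>_def using xs(3) t cp by (intro permutes_compose permutes_subset[OF t] permutes_subset[OF cp]) auto
  have sc: "\<sigma> y = c y" if "y \<in> set xs" for y
    using that t by (simp add: \<sigma>_def permutes_def)
  have st: "\<sigma> y = \<tau> y" if "y \<in> S - set xs" for y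
    using permutes_in_image[OF t, of y] that cp by (simp add: \<sigma>_def permutes_def)
  have hd: "hd xs \<in> set xs" using ne by simp
  have cpow: "(c ^^ i) (hd xs) \<in> set xs" for i
    using ne xs(1) by (simp add: c_def cycle_of_list_funpow)
  have pow: "(\<sigma> ^^ i) (hd xs) = (c ^^ i) (hd xs)" for i
    by (induction i) (use cpow sc in auto)
  have "orbit \<sigma> (hd xs) = orbit c (hd xs)"
    by (simp add: orbit_altdef pow)
  then have orb: "orbit \<sigma> (hd xs) = set xs"
    using orbit_cycle_of_list[OF xs(1) ne] by (simp add: c_def)
  have cyc: "cyclic_on \<sigma> (set xs)"
    using orb hd by (auto simp: cyclic_on_def)
  have "cycles_on S \<sigma> = insert (set xs) (cycles_on (S - set xs) \<tau>)"
    by (rule cycles_on_split[OF cyc xs(3) st])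
  moreover have card: "card (set xs) = l" using xs by (simp add: distinct_card)
  ultimately have "\<sigma> \<in> perms_on A S" using s \<tau> assms(2) by (auto simp: perms_on_def)
  then have "(\<sigma>, hd xs) \<in> ?D" using hd xs(3) card orb by auto
  moreover have "map (\<lambda>i. (\<sigma> ^^ i) (hd xs)) [0..<l] = xs"
    using xs ne by (intro nth_equalityI) (simp_all add: pow c_def cycle_of_list_funpow)
  moreover have "perm_restrict \<sigma> (S - set xs) = \<tau>"
    using st t by (auto simp: perm_restrict_def fun_eq_iff permutes_def)
  ultimately show "w \<in> ?f ` ?D"
    unfolding w using orb by (intro image_eqI[of _ _ "(\<sigma>, hd xs)"]) auto
qed

section \<open>Factorial moments by repeated removal\<close>

text \<open>The factor \<open>l * num_cycles_on S l \<sigma>\<close> counts the marked points on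
  \<open>l\<close>-cycles. Transport along \<open>marked_cycle_bij\<close> removes the marked cycle,
  which lowers the number of \<open>l\<close>-cycles by one.\<close>

lemma sum_cycle_removal:
  fixes h :: "nat \<Rightarrow> nat"
  assumes "finite S" "l \<in> A" "0 < l"
  shows "(\<Sum>\<sigma>\<in>perms_on A S. l * num_cycles_on S l \<sigma> * h (num_cycles_on S l \<sigma> - 1)) =
    (\<Sum>xs\<in>dlists l S. \<Sum>\<tau>\<in>perms_on A (S - set xs). h (num_cycles_on (S - set xs) l \<tau>))"
proof -
  let ?N = "\<lambda>\<sigma>. num_cycles_on S l \<sigma>"
  have "(\<Sum>\<sigma>\<in>perms_on A S. l * ?N \<sigma> * h (?N \<sigma> - 1)) =
    (\<Sum>\<sigma>\<in>perms_on A S. \<Sum>x\<in>{x \<in> S. card (orbit \<sigma> x) = l}. h (?N \<sigma> - 1))"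
    using card_points_in_cycles[OF _ assms(1), of _ l] by (intro sum.cong) (auto simp: perms_on_def)
  also have "\<dots> = (\<Sum>(\<sigma>, x)\<in>(SIGMA \<sigma>:perms_on A S. {x \<in> S. card (orbit \<sigma> x) = l}). h (?N \<sigma> - 1))"
    using assms(1) by (intro sum.Sigma) (auto simp: finite_perms_on)
  also have "\<dots> = (\<Sum>(xs, \<tau>)\<in>(SIGMA xs:dlists l S. perms_on A (S - set xs)).
      h (num_cycles_on (S - set xs) l \<tau>))"
  proof (subst sum.reindex_bij_betw[OF marked_cycle_bij[OF assms], symmetric], rule sum.cong[OF refl], clarify)
    fix \<sigma> x assume s: "\<sigma> \<in> perms_on A S" "x \<in> S" "l = card (orbit \<sigma> x)"
    then have p: "\<sigma> permutes S" by (simp add: perms_on_def)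
    have "?N \<sigma> = Suc (num_cycles_on (S - orbit \<sigma> x) l (perm_restrict \<sigma> (S - orbit \<sigma> x)))"
      using orbit_mem_cycles_on[OF p assms(1) s(2)] s(3) assms(1)
      by (intro num_cycles_on_split) (auto simp: cycles_on_def perm_restrict_def)
    then show "h (num_cycles_on S (card (orbit \<sigma> x)) \<sigma> - 1) =
      h (num_cycles_on (S - set (map (\<lambda>i. (\<sigma> ^^ i) x) [0..<card (orbit \<sigma> x)])) (card (orbit \<sigma> x))
        (perm_restrict \<sigma> (S - orbit \<sigma> x)))"
      using orbit_list(2)[OF p assms(1) s(2) refl] s(3) by simp
  qed
  also have "\<dots> = (\<Sum>xs\<in>dlists l S. \<Sum>\<tau>\<in>perms_on A (S - set xs). h (num_cycles_on (S - set xs) l \<tau>))"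
    using assms(1) by (intro sum.Sigma[symmetric]) (auto simp: finite_perms_on finite_dlists)
  finally show ?thesis .
qed

text \<open>Concatenation is a bijection whose inverse cuts a list after \<open>j\<close> entries.
  It merges the lists produced by successive removals.\<close>

lemma sum_dlists_append:
  assumes "finite S"
  shows "(\<Sum>xs\<in>dlists j S. \<Sum>ys\<in>dlists k (S - set xs). h (xs @ ys)) = (\<Sum>zs\<in>dlists (j + k) S. h zs)"
proof -
  have "(\<Sum>xs\<in>dlists j S. \<Sum>ys\<in>dlists k (S - set xs). h (xs @ ys)) =
    (\<Sum>(xs, ys)\<in>(SIGMA xs:dlists j S. dlists k (S - set xs)). h (xs @ ys))"
    using assms by (intro sum.Sigma) (auto simp: finite_dlists)
  also have "\<dots> = (\<Sum>zs\<in>dlists (j + k) S. h zs)"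
    by (rule sum.reindex_bij_witness[of _ "\<lambda>zs. (take j zs, drop j zs)" "\<lambda>(xs, ys). xs @ ys"])
      (auto simp: dlists_def set_take_disj_set_drop_if_distinct
        dest: in_set_takeD in_set_dropD disjoint_iff[THEN iffD1, OF set_take_disj_set_drop_if_distinct])
  finally show ?thesis .
qed

text \<open>The right-hand side depends on \<open>l\<close> and \<open>m\<close> only through \<open>l * m\<close>. This relates the factorial
  moments of the numbers of cycles of two different lengths.\<close>
lemma sum_ffact_num_cycles_on:
  assumes "finite S" "l \<in> A" "0 < l"
  shows "l ^ m * (\<Sum>\<sigma>\<in>perms_on A S. ffact (num_cycles_on S l \<sigma>) m) =
    (\<Sum>xs\<in>dlists (l * m) S. card (perms_on A (S - set xs)))"
  using assms(1)
proof (induction m arbitrary: S)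
  case 0
  have "dlists 0 S = {[]}" by (auto simp: dlists_def)
  then show ?case by simp
next
  case (Suc m)
  \<comment> \<open>The first factor of the falling factorial, with one factor \<open>l\<close>,
    pays for marking one cycle; what remains is the falling factorial for the permutation without
    that cycle.\<close>
  have "l ^ Suc m * (\<Sum>\<sigma>\<in>perms_on A S. ffact (num_cycles_on S l \<sigma>) (Suc m)) =
    l ^ m * (\<Sum>\<sigma>\<in>perms_on A S. l * num_cycles_on S l \<sigma> * ffact (num_cycles_on S l \<sigma> - 1) m)"
    by (simp add: ffact_Suc_left sum_distrib_left mult_ac)
  also have "\<dots> = (\<Sum>xs\<in>dlists l S. l ^ m *
      (\<Sum>\<tau>\<in>perms_on A (S - set xs). ffact (num_cycles_on (S - set xs) l \<tau>) m))"
    by (simp only: sum_cycle_removal[OF Suc.prems assms(2,3), of "\<lambda>N. ffact N m"] sum_distrib_left)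
  also have "\<dots> = (\<Sum>xs\<in>dlists l S. \<Sum>ys\<in>dlists (l * m) (S - set xs). card (perms_on A (S - set (xs @ ys))))"
    using Suc.IH Suc.prems by (intro sum.cong) (auto simp: Diff_eq Int_assoc)
  also have "\<dots> = (\<Sum>xs\<in>dlists (l * Suc m) S. card (perms_on A (S - set xs)))"
    using sum_dlists_append[OF Suc.prems, of "\<lambda>zs. card (perms_on A (S - set zs))" "l * m" l]
    by simp
  finally show ?case .
qed

section \<open>Elementary inequalities\<close>

lemma ffact_le_power: "ffact N m \<le> N ^ m"
proof -
  have "ffact N m \<le> (\<Prod>i<m. N)"
    unfolding ffact_def by (rule prod_mono) auto
  then show ?thesis by simp
qed

text \<open>The error is of lower order in \<open>N\<close>, so power moments and factorial moments
  agree asymptotically. In the induction, passing from the factor \<open>N\<close> to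
  \<open>N - m\<close> costs at most \<open>m * N ^ m\<close>, and
  \<open>m\<^sup>2 + m \<le> (Suc m)\<^sup>2\<close>.\<close>

lemma power_le_ffact_add: "N ^ m \<le> ffact N m + m\<^sup>2 * N ^ (m - 1)"
proof (induction m)
  case (Suc m)
  have "N * (m\<^sup>2 * N ^ (m - 1)) \<le> m\<^sup>2 * N ^ m"
    by (cases m) auto
  moreover have "N * ffact N m \<le> ffact N (Suc m) + m * ffact N m"
    unfolding ffact_Suc by (cases "m \<le> N") (auto simp: algebra_simps diff_mult_distrib2)
  moreover have "m * ffact N m \<le> m * N ^ m"
    using ffact_le_power by simp
  moreover have "N * N ^ m \<le> N * ffact N m + N * (m\<^sup>2 * N ^ (m - 1))"
    using mult_le_mono2[OF Suc, of N] by (simp add: distrib_left)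
  moreover have "m\<^sup>2 * N ^ m + m * N ^ m \<le> (Suc m)\<^sup>2 * N ^ m"
    unfolding distrib_right[symmetric] by (rule mult_le_mono1) (simp add: power2_eq_square)
  ultimately have "N * N ^ m \<le> ffact N (Suc m) + (Suc m)\<^sup>2 * N ^ m" by linarith
  then show ?case by simp
qed simp

text \<open>For \<open>2 * m \<le> N\<close> every factor \<open>N - i\<close> is at least half of
  \<open>N\<close>; smaller \<open>N\<close> go into the constant. Cruder than the previous bound,
  but free of lower moments, hence available before moments are known to be bounded.\<close>

lemma power_le_two_power_ffact: "N ^ m \<le> 2 ^ m * ffact N m + (2 * m) ^ m"
proof (cases "2 * m \<le> N")
  case True
  have "N ^ m = (\<Prod>i<m. N)" by simp
  also have "\<dots> \<le> (\<Prod>i<m. 2 * (N - i))"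
    using True by (intro prod_mono) auto
  also have "\<dots> = 2 ^ m * ffact N m"
    by (simp add: ffact_def prod.distrib)
  finally show ?thesis by simp
next
  case False
  then have "N ^ m \<le> (2 * m) ^ m" by (intro power_mono) auto
  then show ?thesis by simp
qed

text \<open>Superadditivity of the \<open>d\<close>-th power on nonnegative reals,
  \<open>(u - v) ^ d + v ^ d \<le> u ^ d\<close>. It carries convergence of \<open>X ^ d\<close>
  over to \<open>X\<close>.\<close>

lemma abs_diff_power_le:
  fixes x c :: real
  assumes "0 \<le> x" "0 \<le> c" "0 < d"
  shows "\<bar>x - c\<bar> ^ d \<le> \<bar>x ^ d - c ^ d\<bar>"
proof -
  have *: "(u - v) ^ d \<le> u ^ d - v ^ d" if "0 \<le> v" "v \<le> u" for u v :: real
  proof -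
    have "(u - v) ^ d + v ^ d \<le> u ^ d" using \<open>0 < d\<close>
    proof (induction d rule: nat_induct_non_zero)
      case (Suc n)
      have "(u - v) * (u - v) ^ n \<le> u * (u - v) ^ n - v * 0"
        using that by (simp add: mult_right_mono)
      moreover have "v * v ^ n \<le> u * v ^ n"
        using that by (intro mult_right_mono) auto
      ultimately have "(u - v) ^ Suc n + v ^ Suc n \<le> u * ((u - v) ^ n + v ^ n)"
        by (simp add: distrib_left)
      also have "\<dots> \<le> u * u ^ n" using Suc that by (intro mult_left_mono) auto
      finally show ?case by simp
    qed simp
    then show ?thesis by simp
  qed
  show ?thesis
  proof (cases "c \<le> x")
    case True
    then show ?thesis using *[of c x] assms power_mono[of c x d] by simp
  next
    case False
    then show ?thesis using *[of x c] assms power_mono[of x c d] by (simp add: abs_if)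
  qed
qed

text \<open>Up to \<open>\<delta>\<close> the term 1 suffices, and beyond \<open>\<delta>\<close>
  the larger exponent \<open>q\<close> dominates. A real exponent is thus controlled by one integer
  moment, up to the small term \<open>\<delta> powr p\<close>.\<close>

lemma powr_le_power_split:
  fixes y p \<delta> :: real
  assumes "0 \<le> y" "0 < \<delta>" "0 \<le> p" "p \<le> real q"
  shows "y powr p \<le> \<delta> powr p * (1 + (y / \<delta>) ^ q)"
proof -
  have "(y / \<delta>) powr p \<le> 1 + (y / \<delta>) ^ q"
  proof (cases "y \<le> \<delta>")
    case True
    then have "(y / \<delta>) powr p \<le> 1" using assms by (intro powr_le1) auto
    then show ?thesis using assms by (simp add: add_increasing2)
  next
    case False
    then have "(y / \<delta>) powr p \<le> (y / \<delta>) powr real q" using assms by (intro powr_mono) auto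
    then show ?thesis using False assms by (simp add: powr_realpow)
  qed
  then have "\<delta> powr p * (y / \<delta>) powr p \<le> \<delta> powr p * (1 + (y / \<delta>) ^ q)"
    by (intro mult_left_mono) auto
  then show ?thesis using assms by (simp add: powr_divide)
qed

section \<open>Averages over finite sets\<close>

text \<open>The expectation under the uniform distribution on a finite nonempty \<open>P\<close>.
  For empty or infinite \<open>P\<close> the value is 0, so linearity and monotonicity hold for
  every \<open>P\<close>.\<close>

definition avg :: "'a set \<Rightarrow> ('a \<Rightarrow> real) \<Rightarrow> real" where
  "avg P f = (\<Sum>x\<in>P. f x) / real (card P)"

lemma avg_add: "avg P (\<lambda>x. f x + g x) = avg P f + avg P g"
  by (simp add: avg_def sum.distrib add_divide_distrib)

lemma avg_cmult: "avg P (\<lambda>x. c * f x) = c * avg P f"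
  by (simp add: avg_def sum_distrib_left[symmetric])

lemma avg_multc: "avg P (\<lambda>x. f x * c) = avg P f * c"
  by (simp add: avg_def sum_distrib_right[symmetric])

lemma avg_divide: "avg P (\<lambda>x. f x / c) = avg P f / c"
  by (simp add: avg_def sum_divide_distrib[symmetric] field_simps)

lemma avg_sum: "avg P (\<lambda>x. \<Sum>i\<in>I. f i x) = (\<Sum>i\<in>I. avg P (f i))"
  unfolding avg_def by (subst sum.swap) (simp add: sum_divide_distrib)

lemma avg_const: "finite P \<Longrightarrow> P \<noteq> {} \<Longrightarrow> avg P (\<lambda>x. c) = c"
  by (simp add: avg_def)

lemma avg_mono: "(\<And>x. x \<in> P \<Longrightarrow> f x \<le> g x) \<Longrightarrow> avg P f \<le> avg P g"
  by (simp add: avg_def sum_mono divide_right_mono)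

lemma avg_nonneg: "(\<And>x. x \<in> P \<Longrightarrow> 0 \<le> f x) \<Longrightarrow> 0 \<le> avg P f"
  by (simp add: avg_def sum_nonneg)

lemma perms_with_lengths_eq: "perms_with_lengths A n = perms_on A {1..n}"
  by (simp add: perms_with_lengths_def perms_on_def cycles_def cycles_on_def)

lemma num_cycles_eq: "num_cycles n l = num_cycles_on {1..n} l"
  by (simp add: num_cycles_def num_cycles_on_def cycles_def cycles_on_def fun_eq_iff)

section \<open>Asymptotics of the moments\<close>

locale cycle_lengths =
  fixes A :: "nat set"
  assumes fin: "finite A" and pos: "\<And>a. a \<in> A \<Longrightarrow> 0 < a" and nonempty: "A \<noteq> {}"
begin

abbreviation d :: nat where "d \<equiv> Max A"
abbreviation P :: "nat \<Rightarrow> (nat \<Rightarrow> nat) set" where "P \<equiv> perms_with_lengths A"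
abbreviation F :: "nat filter" where "F \<equiv> inf sequentially (principal {n. P n \<noteq> {}})"

definition scale :: "nat \<Rightarrow> nat \<Rightarrow> real" where
  "scale l n = real n powr (real l / real d)"

definition X :: "nat \<Rightarrow> nat \<Rightarrow> (nat \<Rightarrow> nat) \<Rightarrow> real" where
  "X l n \<sigma> = real (num_cycles n l \<sigma>) / scale l n"

lemma d: "d \<in> A" "0 < d" "\<And>a. a \<in> A \<Longrightarrow> a \<le> d"
  using fin nonempty pos by auto

lemma eventually_F:
  assumes "\<And>n. 0 < n \<Longrightarrow> P n \<noteq> {} \<Longrightarrow> Q n"
  shows "eventually Q F"
  unfolding eventually_inf_principal
  using eventually_gt_at_top[of 0] by eventually_elim (use assms in auto)

lemma X_nonneg: "0 \<le> X l n \<sigma>"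
  by (simp add: X_def scale_def)

lemma scale_pos: "0 < n \<Longrightarrow> 0 < scale l n"
  by (simp add: scale_def)

text \<open>Moments of order \<open>d * m\<close> clear the fractional exponent
  \<open>l / d\<close>.\<close>

lemma scale_power: "0 < n \<Longrightarrow> scale l n ^ (d * m) = real n ^ (l * m)"
  using d(2) by (simp add: scale_def powr_power powr_realpow[symmetric] powr_powr mult.commute)

lemma scale_d: "0 < n \<Longrightarrow> scale d n = real n"
  using d(2) by (simp add: scale_def)

lemma scale_at_top:
  assumes "l \<in> A"
  shows "filterlim (scale l) at_top F"
proof -
  have "filterlim (scale l) at_top sequentially"
    unfolding scale_def using d(2) pos[OF assms]
    by real_asymp
  then show ?thesis by (rule filterlim_mono) auto
qed

text \<open>By \<open>sum_ffact_num_cycles_on\<close> both sides come from the same sum over lists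
  of \<open>d * l * m\<close> distinct points.\<close>

lemma avg_ffact_exchange:
  assumes "l \<in> A"
  shows "real l ^ (d * m) * avg (P n) (\<lambda>\<sigma>. real (ffact (num_cycles n l \<sigma>) (d * m))) =
    real d ^ (l * m) * avg (P n) (\<lambda>\<sigma>. real (ffact (num_cycles n d \<sigma>) (l * m)))"
proof -
  have "l ^ (d * m) * (\<Sum>\<sigma>\<in>P n. ffact (num_cycles n l \<sigma>) (d * m)) =
    d ^ (l * m) * (\<Sum>\<sigma>\<in>P n. ffact (num_cycles n d \<sigma>) (l * m))"
    unfolding perms_with_lengths_eq num_cycles_eq
    using assms d(1) pos by (simp add: sum_ffact_num_cycles_on mult_ac)
  then have "real (l ^ (d * m) * (\<Sum>\<sigma>\<in>P n. ffact (num_cycles n l \<sigma>) (d * m))) =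
    real (d ^ (l * m) * (\<Sum>\<sigma>\<in>P n. ffact (num_cycles n d \<sigma>) (l * m)))"
    by (simp only:)
  then show ?thesis by (simp add: avg_def field_simps)
qed

lemma sum_num_cycles: "\<sigma> \<in> P n \<Longrightarrow> (\<Sum>k\<in>A. k * num_cycles n k \<sigma>) = n"
  unfolding perms_with_lengths_eq num_cycles_eq
  using sum_num_cycles_on[of \<sigma> A "{1..n}"] fin by simp

lemma num_cycles_d_le: "\<sigma> \<in> P n \<Longrightarrow> d * num_cycles n d \<sigma> \<le> n"
  using member_le_sum[OF d(1) _ fin, of "\<lambda>k. k * num_cycles n k \<sigma>"] sum_num_cycles[of \<sigma> n] by simp

text \<open>The exchange reduces the claim to cycles of length \<open>d\<close>, where
  \<open>d * num_cycles n d \<sigma> \<le> n\<close> holds pointwise.\<close>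

lemma avg_ffact_le:
  assumes "l \<in> A" "P n \<noteq> {}"
  shows "avg (P n) (\<lambda>\<sigma>. real (ffact (num_cycles n l \<sigma>) (d * m))) \<le> real n ^ (l * m)"
proof -
  let ?a = "avg (P n) (\<lambda>\<sigma>. real (ffact (num_cycles n l \<sigma>) (d * m)))"
  have "1 * ?a \<le> real l ^ (d * m) * ?a"
    using pos[OF assms(1)] by (intro mult_right_mono avg_nonneg one_le_power) auto
  also have "\<dots> = avg (P n) (\<lambda>\<sigma>. real d ^ (l * m) * real (ffact (num_cycles n d \<sigma>) (l * m)))"
    using avg_ffact_exchange[OF assms(1)] by (simp add: avg_cmult)
  also have "\<dots> \<le> avg (P n) (\<lambda>\<sigma>. real n ^ (l * m))"
  proof (rule avg_mono)
    fix \<sigma> assume "\<sigma> \<in> P n"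
    have "d ^ (l * m) * ffact (num_cycles n d \<sigma>) (l * m) \<le> d ^ (l * m) * num_cycles n d \<sigma> ^ (l * m)"
      using ffact_le_power by simp
    also have "\<dots> \<le> n ^ (l * m)"
      unfolding power_mult_distrib[symmetric] using num_cycles_d_le[OF \<open>\<sigma> \<in> P n\<close>] by (rule power_mono) simp
    finally show "real d ^ (l * m) * real (ffact (num_cycles n d \<sigma>) (l * m)) \<le> real n ^ (l * m)"
      by (metis of_nat_le_iff of_nat_mult of_nat_power)
  qed
  finally show ?thesis
    using assms finite_perms_with_lengths by (simp add: avg_const)
qed

text \<open>The \<open>m\<close>-th moment is at most 1 plus the moment of order
  \<open>d * m\<close>, which is compared with the factorial moment bounded in
  \<open>avg_ffact_le\<close>.\<close>

lemma moments_bounded: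
  assumes "l \<in> A"
  obtains B where "\<And>n. 0 < n \<Longrightarrow> P n \<noteq> {} \<Longrightarrow> avg (P n) (\<lambda>\<sigma>. X l n \<sigma> ^ m) \<le> B"
proof
  fix n :: nat assume n: "0 < n" "P n \<noteq> {}"
  let ?k = "d * m"
  have "avg (P n) (\<lambda>\<sigma>. X l n \<sigma> ^ m) \<le>
    avg (P n) (\<lambda>\<sigma>. (1 + real (2 * ?k) ^ ?k) +
      2 ^ ?k / real n ^ (l * m) * real (ffact (num_cycles n l \<sigma>) ?k))"
  proof (rule avg_mono)
    fix \<sigma>
    have "X l n \<sigma> ^ m \<le> 1 + X l n \<sigma> ^ ?k"
    proof (cases "X l n \<sigma> \<le> 1")
      case True
      then have "X l n \<sigma> ^ m \<le> 1" using X_nonneg by (intro power_le_one) auto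
      then show ?thesis using X_nonneg[of l n \<sigma>] by (simp add: add_increasing2)
    next
      case False
      then have "X l n \<sigma> ^ m \<le> X l n \<sigma> ^ ?k" using d(2) by (intro power_increasing) auto
      then show ?thesis by simp
    qed
    also have "X l n \<sigma> ^ ?k = real (num_cycles n l \<sigma> ^ ?k) / real n ^ (l * m)"
      using n by (simp add: X_def power_divide scale_power)
    also have "\<dots> \<le> real (2 ^ ?k * ffact (num_cycles n l \<sigma>) ?k + (2 * ?k) ^ ?k) / real n ^ (l * m)"
      using power_le_two_power_ffact by (intro divide_right_mono) (simp_all only: of_nat_le_iff, simp)
    also have "\<dots> = 2 ^ ?k / real n ^ (l * m) * real (ffact (num_cycles n l \<sigma>) ?k)
        + real (2 * ?k) ^ ?k / real n ^ (l * m)"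
      by (simp add: add_divide_distrib)
    also have "real (2 * ?k) ^ ?k / real n ^ (l * m) \<le> real (2 * ?k) ^ ?k / 1"
      using n by (intro divide_left_mono) (auto intro: one_le_power)
    finally show "X l n \<sigma> ^ m \<le> (1 + real (2 * ?k) ^ ?k) +
      2 ^ ?k / real n ^ (l * m) * real (ffact (num_cycles n l \<sigma>) ?k)" by simp
  qed
  also have "\<dots> = (1 + real (2 * ?k) ^ ?k) +
      2 ^ ?k / real n ^ (l * m) * avg (P n) (\<lambda>\<sigma>. real (ffact (num_cycles n l \<sigma>) ?k))"
    using n finite_perms_with_lengths by (simp add: avg_add avg_cmult avg_divide avg_const)
  also have "\<dots> \<le> (1 + real (2 * ?k) ^ ?k) + 2 ^ ?k / real n ^ (l * m) * real n ^ (l * m)"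
    using avg_ffact_le[OF assms n(2)] by (intro add_left_mono mult_left_mono) auto
  also have "\<dots> = (1 + real (2 * ?k) ^ ?k) + 2 ^ ?k"
    using n by simp
  finally show "avg (P n) (\<lambda>\<sigma>. X l n \<sigma> ^ m) \<le> (1 + real (2 * ?k) ^ ?k) + 2 ^ ?k" .
qed

text \<open>Pointwise the difference lies between 0 and
  \<open>m\<^sup>2 / scale l n * X l n \<sigma> ^ (m - 1)\<close>; the moment of order
  \<open>m - 1\<close> is bounded and \<open>scale l\<close> tends to infinity. For
  \<open>m = 0\<close> the truncated exponent is harmless, as the factor \<open>m\<^sup>2\<close>
  vanishes.\<close>

lemma avg_power_minus_ffact_tendsto:
  assumes "l \<in> A"
  shows "((\<lambda>n. avg (P n) (\<lambda>\<sigma>. X l n \<sigma> ^ m) -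
    avg (P n) (\<lambda>\<sigma>. real (ffact (num_cycles n l \<sigma>) m)) / scale l n ^ m) \<longlongrightarrow> 0) F"
proof -
  obtain B where B: "\<And>n. 0 < n \<Longrightarrow> P n \<noteq> {} \<Longrightarrow> avg (P n) (\<lambda>\<sigma>. X l n \<sigma> ^ (m - 1)) \<le> B"
    using moments_bounded[OF assms, of "m - 1"] by blast
  let ?D = "\<lambda>n. avg (P n) (\<lambda>\<sigma>. X l n \<sigma> ^ m) -
    avg (P n) (\<lambda>\<sigma>. real (ffact (num_cycles n l \<sigma>) m)) / scale l n ^ m"
  have "((\<lambda>n. real (m\<^sup>2) * B / scale l n) \<longlongrightarrow> 0) F"
    by (rule tendsto_divide_0[OF tendsto_const]) 
      (rule filterlim_at_top_imp_at_infinity[OF scale_at_top[OF assms]])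
  moreover have "eventually (\<lambda>n. 0 \<le> ?D n) F"
  proof (rule eventually_F)
    fix n assume n: "0 < n" "P n \<noteq> {}"
    have "avg (P n) (\<lambda>\<sigma>. real (ffact (num_cycles n l \<sigma>) m) / scale l n ^ m) \<le> avg (P n) (\<lambda>\<sigma>. X l n \<sigma> ^ m)"
    proof (rule avg_mono)
      fix \<sigma>
      have "real (ffact (num_cycles n l \<sigma>) m) \<le> real (num_cycles n l \<sigma>) ^ m"
        using ffact_le_power by (metis of_nat_le_iff of_nat_power)
      then show "real (ffact (num_cycles n l \<sigma>) m) / scale l n ^ m \<le> X l n \<sigma> ^ m"
        using scale_pos[OF n(1), of l] by (simp add: X_def power_divide divide_right_mono)
    qed
    then show "0 \<le> ?D n" by (simp add: avg_divide)
  qed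
  moreover have "eventually (\<lambda>n. ?D n \<le> real (m\<^sup>2) * B / scale l n) F"
  proof (rule eventually_F)
    fix n assume n: "0 < n" "P n \<noteq> {}"
    note s = scale_pos[OF n(1), of l]
    have "avg (P n) (\<lambda>\<sigma>. X l n \<sigma> ^ m) \<le>
      avg (P n) (\<lambda>\<sigma>. real (ffact (num_cycles n l \<sigma>) m) / scale l n ^ m +
        real (m\<^sup>2) / scale l n * X l n \<sigma> ^ (m - 1))"
    proof (rule avg_mono)
      fix \<sigma>
      let ?N = "num_cycles n l \<sigma>"
      have "X l n \<sigma> ^ m = real (?N ^ m) / scale l n ^ m"
        by (simp add: X_def power_divide)
      also have "\<dots> \<le> real (ffact ?N m + m\<^sup>2 * ?N ^ (m - 1)) / scale l n ^ m"
        using power_le_ffact_add s by (intro divide_right_mono) (simp_all only: of_nat_le_iff, simp)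
      also have "\<dots> = real (ffact ?N m) / scale l n ^ m + real (m\<^sup>2) / scale l n * X l n \<sigma> ^ (m - 1)"
        using s by (cases m) (simp_all add: X_def power_divide add_divide_distrib)
      finally show "X l n \<sigma> ^ m \<le> \<dots>" .
    qed
    also have "\<dots> = avg (P n) (\<lambda>\<sigma>. real (ffact (num_cycles n l \<sigma>) m)) / scale l n ^ m +
        real (m\<^sup>2) / scale l n * avg (P n) (\<lambda>\<sigma>. X l n \<sigma> ^ (m - 1))"
      by (simp only: avg_add avg_cmult avg_divide)
    also have "real (m\<^sup>2) / scale l n * avg (P n) (\<lambda>\<sigma>. X l n \<sigma> ^ (m - 1)) \<le> real (m\<^sup>2) / scale l n * B"
      using B[OF n] s by (intro mult_left_mono) auto
    finally show "?D n \<le> real (m\<^sup>2) * B / scale l n" by simp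
  qed
  ultimately show ?thesis
    by (rule tendsto_sandwich[OF _ _ tendsto_const, rotated 2])
qed

section \<open>Limits of the moments\<close>

text \<open>The mean is at most a constant times \<open>n powr (l / d)\<close>, and
  \<open>l / d < 1\<close>.\<close>

lemma avg_short_cycles_tendsto:
  assumes "l \<in> A" "l < d"
  shows "((\<lambda>n. avg (P n) (\<lambda>\<sigma>. real (num_cycles n l \<sigma>)) / real n) \<longlongrightarrow> 0) F"
proof -
  obtain B where B: "\<And>n. 0 < n \<Longrightarrow> P n \<noteq> {} \<Longrightarrow> avg (P n) (\<lambda>\<sigma>. X l n \<sigma> ^ 1) \<le> B"
    using moments_bounded[OF assms(1), of 1] by blast
  have "((\<lambda>n. B * real n powr (real l / real d - 1)) \<longlongrightarrow> B * 0) sequentially"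
    using assms(2) by (intro tendsto_mult tendsto_const tendsto_neg_powr filterlim_real_sequentially) auto
  then have "((\<lambda>n. B * real n powr (real l / real d - 1)) \<longlongrightarrow> 0) F"
    by (simp add: tendsto_mono[OF inf_le1])
  moreover have "eventually (\<lambda>n. 0 \<le> avg (P n) (\<lambda>\<sigma>. real (num_cycles n l \<sigma>)) / real n) F"
    by (intro always_eventually allI divide_nonneg_nonneg avg_nonneg) auto
  moreover have "eventually (\<lambda>n. avg (P n) (\<lambda>\<sigma>. real (num_cycles n l \<sigma>)) / real n
      \<le> B * real n powr (real l / real d - 1)) F"
  proof (rule eventually_F)
    fix n assume n: "0 < n" "P n \<noteq> {}"
    have "real n powr (real l / real d - 1) = scale l n / real n"
      using n by (simp add: scale_def powr_diff)
    moreover have "avg (P n) (\<lambda>\<sigma>. real (num_cycles n l \<sigma>)) \<le> B * scale l n"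
      using B[OF n] scale_pos[OF n(1), of l] by (simp add: X_def avg_divide field_simps)
    ultimately show "avg (P n) (\<lambda>\<sigma>. real (num_cycles n l \<sigma>)) / real n
      \<le> B * real n powr (real l / real d - 1)"
      by (simp add: divide_right_mono)
  qed
  ultimately show ?thesis
    by (rule tendsto_sandwich[OF _ _ tendsto_const, rotated 2])
qed

text \<open>The share \<open>d * X d n \<sigma>\<close> of points on \<open>d\<close>-cycles is at
  most 1 and falls short of 1 by the share on shorter cycles, whose mean tends to 0. Bernoulli's
  inequality passes from the mean to the \<open>m\<close>-th power.\<close>

lemma avg_X_d_power_tendsto: "((\<lambda>n. avg (P n) (\<lambda>\<sigma>. X d n \<sigma> ^ m)) \<longlongrightarrow> (1 / real d) ^ m) F"
proof -
  let ?Y = "\<lambda>n \<sigma>. real d * X d n \<sigma>"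
  let ?L = "\<lambda>n. 1 - real m * (\<Sum>k\<in>A - {d}. real k * (avg (P n) (\<lambda>\<sigma>. real (num_cycles n k \<sigma>)) / real n))"
  have "(?L \<longlongrightarrow> 1 - real m * (\<Sum>k\<in>A - {d}. real k * 0)) F"
    using d(3) by (intro tendsto_intros avg_short_cycles_tendsto) (auto simp: less_le)
  then have "(?L \<longlongrightarrow> 1) F" by simp
  moreover have "eventually (\<lambda>n. ?L n \<le> avg (P n) (\<lambda>\<sigma>. ?Y n \<sigma> ^ m)) F"
  proof (rule eventually_F)
    fix n assume n: "0 < n" "P n \<noteq> {}"
    have "?L n = avg (P n) (\<lambda>\<sigma>. 1 + (- real m) * (\<Sum>k\<in>A - {d}. real k * (real (num_cycles n k \<sigma>) / real n)))"
      by (simp only: avg_add avg_cmult avg_sum avg_divide avg_const[OF finite_perms_with_lengths n(2)])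
    also have "\<dots> \<le> avg (P n) (\<lambda>\<sigma>. ?Y n \<sigma> ^ m)"
    proof (rule avg_mono)
      fix \<sigma> assume "\<sigma> \<in> P n"
      have "real n = real (\<Sum>k\<in>A. k * num_cycles n k \<sigma>)"
        using sum_num_cycles[OF \<open>\<sigma> \<in> P n\<close>] by simp
      also have "\<dots> = real d * real (num_cycles n d \<sigma>) + (\<Sum>k\<in>A - {d}. real k * real (num_cycles n k \<sigma>))"
        using sum.remove[OF fin d(1)] by simp
      finally have "real n / real n =
          (real d * real (num_cycles n d \<sigma>) + (\<Sum>k\<in>A - {d}. real k * real (num_cycles n k \<sigma>))) / real n"
        by (rule arg_cong)
      then have "1 = ?Y n \<sigma> + (\<Sum>k\<in>A - {d}. real k * real (num_cycles n k \<sigma>)) / real n"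
        using n(1) by (simp add: X_def scale_d add_divide_distrib)
      then have eq: "(\<Sum>k\<in>A - {d}. real k * (real (num_cycles n k \<sigma>) / real n)) = 1 - ?Y n \<sigma>"
        by (simp add: sum_divide_distrib)
      have "1 + real m * (?Y n \<sigma> - 1) \<le> (1 + (?Y n \<sigma> - 1)) ^ m"
        using X_nonneg by (intro Bernoulli_inequality) auto
      moreover have "1 + (- real m) * (1 - ?Y n \<sigma>) = 1 + real m * (?Y n \<sigma> - 1)"
        by (simp add: algebra_simps)
      ultimately show "1 + (- real m) * (\<Sum>k\<in>A - {d}. real k * (real (num_cycles n k \<sigma>) / real n))
          \<le> ?Y n \<sigma> ^ m"
        unfolding eq by simp
    qed
    finally show "?L n \<le> avg (P n) (\<lambda>\<sigma>. ?Y n \<sigma> ^ m)" .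
  qed
  moreover have "eventually (\<lambda>n. avg (P n) (\<lambda>\<sigma>. ?Y n \<sigma> ^ m) \<le> 1) F"
  proof (rule eventually_F)
    fix n assume n: "0 < n" "P n \<noteq> {}"
    have "avg (P n) (\<lambda>\<sigma>. ?Y n \<sigma> ^ m) \<le> avg (P n) (\<lambda>\<sigma>. 1)"
    proof (rule avg_mono)
      fix \<sigma> assume "\<sigma> \<in> P n"
      then have "real (d * num_cycles n d \<sigma>) \<le> real n" using num_cycles_d_le by (simp only: of_nat_le_iff)
      then have "?Y n \<sigma> \<le> 1" using n by (simp add: X_def scale_d)
      then show "?Y n \<sigma> ^ m \<le> 1" using X_nonneg by (intro power_le_one) auto
    qed
    then show "avg (P n) (\<lambda>\<sigma>. ?Y n \<sigma> ^ m) \<le> 1"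
      using n finite_perms_with_lengths by (simp add: avg_const)
  qed
  ultimately have "((\<lambda>n. avg (P n) (\<lambda>\<sigma>. ?Y n \<sigma> ^ m)) \<longlongrightarrow> 1) F"
    by (rule tendsto_sandwich[OF _ _ _ tendsto_const, rotated 2])
  then have "((\<lambda>n. (1 / real d) ^ m * avg (P n) (\<lambda>\<sigma>. ?Y n \<sigma> ^ m)) \<longlongrightarrow> (1 / real d) ^ m * 1) F"
    by (intro tendsto_intros)
  moreover have "(1 / real d) ^ m * avg (P n) (\<lambda>\<sigma>. ?Y n \<sigma> ^ m) = avg (P n) (\<lambda>\<sigma>. X d n \<sigma> ^ m)" for n
    using d(2) by (simp add: power_mult_distrib avg_cmult power_divide)
  ultimately show ?thesis by simp
qed

text \<open>From power moments of \<open>X d\<close> to factorial moments, across to length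
  \<open>l\<close> by the exchange identity, and back to power moments of
  \<open>X l\<close>.\<close>

lemma avg_X_power_tendsto:
  assumes "l \<in> A"
  shows "((\<lambda>n. avg (P n) (\<lambda>\<sigma>. X l n \<sigma> ^ (d * m))) \<longlongrightarrow> (1 / real l) ^ (d * m)) F"
proof -
  let ?G = "\<lambda>l n m. avg (P n) (\<lambda>\<sigma>. real (ffact (num_cycles n l \<sigma>) m)) / scale l n ^ m"
  have "((\<lambda>n. avg (P n) (\<lambda>\<sigma>. X d n \<sigma> ^ (l * m)) - (avg (P n) (\<lambda>\<sigma>. X d n \<sigma> ^ (l * m)) - ?G d n (l * m)))
      \<longlongrightarrow> (1 / real d) ^ (l * m) - 0) F"
    by (intro tendsto_diff avg_X_d_power_tendsto avg_power_minus_ffact_tendsto d(1))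
  then have "((\<lambda>n. real d ^ (l * m) / real l ^ (d * m) * ?G d n (l * m)) \<longlongrightarrow>
      real d ^ (l * m) / real l ^ (d * m) * (1 / real d) ^ (l * m)) F"
    by (intro tendsto_intros) simp
  moreover have "real d ^ (l * m) / real l ^ (d * m) * (1 / real d) ^ (l * m) = (1 / real l) ^ (d * m)"
    using d(2) by (simp add: power_divide)
  \<comment> \<open>The normalisations match: \<open>scale l n ^ (d * m)\<close> and
    \<open>scale d n ^ (l * m)\<close> both equal \<open>real n ^ (l * m)\<close>.\<close>
  moreover have "eventually (\<lambda>n. real d ^ (l * m) / real l ^ (d * m) * ?G d n (l * m) = ?G l n (d * m)) F"
  proof (rule eventually_F)
    fix n :: nat assume n: "0 < n"
    show "real d ^ (l * m) / real l ^ (d * m) * ?G d n (l * m) = ?G l n (d * m)"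
      using avg_ffact_exchange[OF assms, of m n] pos[OF assms] n
      unfolding scale_power[OF n] scale_d[OF n] by (simp add: field_simps)
  qed
  ultimately have "((\<lambda>n. ?G l n (d * m)) \<longlongrightarrow> (1 / real l) ^ (d * m)) F"
    by (auto intro: Lim_transform_eventually)
  then have "((\<lambda>n. (avg (P n) (\<lambda>\<sigma>. X l n \<sigma> ^ (d * m)) - ?G l n (d * m)) + ?G l n (d * m))
      \<longlongrightarrow> 0 + (1 / real l) ^ (d * m)) F"
    by (intro tendsto_add avg_power_minus_ffact_tendsto assms)
  then show ?thesis by simp
qed

section \<open>From moments to convergence in the mean of order p\<close>

text \<open>Expand binomially and pass to the limit term by term: the result is the expansion of
  \<open>(c - c) ^ m\<close> with \<open>c = (1 / l) ^ d\<close>, which is 0 as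
  \<open>0 < m\<close>.\<close>

lemma avg_centered_power_tendsto:
  assumes "l \<in> A" "0 < m"
  shows "((\<lambda>n. avg (P n) (\<lambda>\<sigma>. (X l n \<sigma> ^ d - (1 / real l) ^ d) ^ m)) \<longlongrightarrow> 0) F"
proof -
  let ?c = "(1 / real l) ^ d"
  have "((\<lambda>n. \<Sum>i\<le>m. of_nat (m choose i) * avg (P n) (\<lambda>\<sigma>. X l n \<sigma> ^ (d * i)) * (- ?c) ^ (m - i))
    \<longlongrightarrow> (\<Sum>i\<le>m. of_nat (m choose i) * (1 / real l) ^ (d * i) * (- ?c) ^ (m - i))) F"
    by (intro tendsto_intros avg_X_power_tendsto assms)
  moreover have "(\<Sum>i\<le>m. of_nat (m choose i) * (1 / real l) ^ (d * i) * (- ?c) ^ (m - i)) = 0"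
    using binomial_ring[of ?c "- ?c" m, symmetric] assms(2) by (simp add: power_mult)
  moreover have "(X l n \<sigma> ^ d - ?c) ^ m =
      (\<Sum>i\<le>m. of_nat (m choose i) * X l n \<sigma> ^ (d * i) * (- ?c) ^ (m - i))" for n \<sigma>
    using binomial_ring[of "X l n \<sigma> ^ d" "- ?c" m] by (simp add: power_mult)
  ultimately show ?thesis by (simp add: avg_sum avg_cmult avg_multc)
qed

text \<open>The even exponent \<open>2 * m\<close> removes the absolute value around the difference
  of \<open>d\<close>-th powers.\<close>

lemma avg_abs_power_tendsto:
  assumes "l \<in> A" "0 < m"
  shows "((\<lambda>n. avg (P n) (\<lambda>\<sigma>. \<bar>X l n \<sigma> - 1 / real l\<bar> ^ (d * (2 * m)))) \<longlongrightarrow> 0) F"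
proof (rule tendsto_sandwich[OF _ _ tendsto_const])
  show "((\<lambda>n. avg (P n) (\<lambda>\<sigma>. (X l n \<sigma> ^ d - (1 / real l) ^ d) ^ (2 * m))) \<longlongrightarrow> 0) F"
    using assms by (intro avg_centered_power_tendsto) auto
  show "eventually (\<lambda>n. 0 \<le> avg (P n) (\<lambda>\<sigma>. \<bar>X l n \<sigma> - 1 / real l\<bar> ^ (d * (2 * m)))) F"
    by (intro always_eventually allI avg_nonneg) auto
  have "\<bar>X l n \<sigma> - 1 / real l\<bar> ^ (d * (2 * m)) \<le> (X l n \<sigma> ^ d - (1 / real l) ^ d) ^ (2 * m)" for n \<sigma>
  proof -
    have "(\<bar>X l n \<sigma> - 1 / real l\<bar> ^ d) ^ (2 * m) \<le> \<bar>X l n \<sigma> ^ d - (1 / real l) ^ d\<bar> ^ (2 * m)"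
      using X_nonneg d(2) by (intro power_mono abs_diff_power_le) auto
    then show ?thesis by (simp add: power_mult)
  qed
  then show "eventually (\<lambda>n. avg (P n) (\<lambda>\<sigma>. \<bar>X l n \<sigma> - 1 / real l\<bar> ^ (d * (2 * m)))
      \<le> avg (P n) (\<lambda>\<sigma>. (X l n \<sigma> ^ d - (1 / real l) ^ d) ^ (2 * m))) F"
    by (intro always_eventually allI avg_mono)
qed

lemma avg_abs_powr_tendsto:
  assumes "l \<in> A" "1 \<le> p"
  shows "((\<lambda>n. avg (P n) (\<lambda>\<sigma>. \<bar>X l n \<sigma> - 1 / real l\<bar> powr p)) \<longlongrightarrow> 0) F"
proof (rule order_tendstoI)
  fix a :: real assume "a < 0"
  moreover have "0 \<le> avg (P n) (\<lambda>\<sigma>. \<bar>X l n \<sigma> - 1 / real l\<bar> powr p)" for n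
    by (rule avg_nonneg) simp
  ultimately show "eventually (\<lambda>n. a < avg (P n) (\<lambda>\<sigma>. \<bar>X l n \<sigma> - 1 / real l\<bar> powr p)) F"
    by (intro always_eventually allI) (rule less_le_trans)
next
  fix \<epsilon> :: real assume "0 < \<epsilon>"
  define m where "m = Suc (nat \<lceil>p\<rceil>)"
  define q where "q = d * (2 * m)"
  \<comment> \<open>Chosen so that \<open>\<delta> powr p\<close> is half of
    \<open>\<epsilon>\<close>; the other half leaves room for the vanishing moment of order
    \<open>q\<close>.\<close>
  define \<delta> where "\<delta> = (\<epsilon> / 2) powr (1 / p)"
  have \<delta>: "0 < \<delta>" "\<delta> powr p = \<epsilon> / 2"
    using \<open>0 < \<epsilon>\<close> assms(2) by (auto simp: \<delta>_def powr_powr)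
  have "p \<le> real m" unfolding m_def by linarith
  also have "m \<le> q" using d(2) by (simp add: q_def)
  finally have pq: "p \<le> real q" by simp
  let ?Z = "\<lambda>n. avg (P n) (\<lambda>\<sigma>. \<bar>X l n \<sigma> - 1 / real l\<bar> ^ q)"
  have "(?Z \<longlongrightarrow> 0) F"
    unfolding q_def using assms(1) by (intro avg_abs_power_tendsto) (simp_all add: m_def)
  then have "((\<lambda>n. \<epsilon> / 2 * (1 + ?Z n / \<delta> ^ q)) \<longlongrightarrow> \<epsilon> / 2 * (1 + 0 / \<delta> ^ q)) F"
    using \<delta>(1) by (intro tendsto_intros) auto
  then have "eventually (\<lambda>n. \<epsilon> / 2 * (1 + ?Z n / \<delta> ^ q) < \<epsilon>) F"
    by (rule order_tendstoD(2)) (use \<open>0 < \<epsilon>\<close> in simp)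
  moreover have "eventually (\<lambda>n. avg (P n) (\<lambda>\<sigma>. \<bar>X l n \<sigma> - 1 / real l\<bar> powr p) \<le> \<epsilon> / 2 * (1 + ?Z n / \<delta> ^ q)) F"
  proof (rule eventually_F)
    fix n assume n: "0 < n" "P n \<noteq> {}"
    have "avg (P n) (\<lambda>\<sigma>. \<bar>X l n \<sigma> - 1 / real l\<bar> powr p) \<le>
      avg (P n) (\<lambda>\<sigma>. \<epsilon> / 2 * (1 + \<bar>X l n \<sigma> - 1 / real l\<bar> ^ q / \<delta> ^ q))"
      using powr_le_power_split[of "\<bar>X l n _ - 1 / real l\<bar>" \<delta> p q] \<delta> pq assms(2)
      by (intro avg_mono) (simp add: power_divide)
    also have "\<dots> = \<epsilon> / 2 * (1 + ?Z n / \<delta> ^ q)"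
      using n finite_perms_with_lengths by (simp add: avg_add avg_cmult avg_divide avg_const)
    finally show "avg (P n) (\<lambda>\<sigma>. \<bar>X l n \<sigma> - 1 / real l\<bar> powr p) \<le> \<epsilon> / 2 * (1 + ?Z n / \<delta> ^ q)" .
  qed
  ultimately show "eventually (\<lambda>n. avg (P n) (\<lambda>\<sigma>. \<bar>X l n \<sigma> - 1 / real l\<bar> powr p) < \<epsilon>) F"
    by eventually_elim simp
qed

end

theorem theorem2p3:
  fixes A :: "nat set" and l :: nat and p :: real
  assumes "finite A" and "\<forall>a\<in>A. a > 0" and "l \<in> A" and "p \<ge> 1"
  shows "((\<lambda>n. measure_pmf.expectation (pmf_of_set (perms_with_lengths A n))
             (\<lambda>\<sigma>. \<bar>real (num_cycles n l \<sigma>) / real n powr (real l / real (Max A)) - 1 / real l\<bar> powr p))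
          \<longlongrightarrow> 0) (inf sequentially (principal {n. perms_with_lengths A n \<noteq> {}}))"
proof -
  interpret cycle_lengths A
    using assms by unfold_locales auto
  \<comment> \<open>\<open>pmf_of_set\<close> is the uniform distribution only for a nonempty finite
    set, so the two sides are identified along \<open>F\<close> rather than for every
    \<open>n\<close>.\<close>
  have "eventually (\<lambda>n. avg (P n) (\<lambda>\<sigma>. \<bar>X l n \<sigma> - 1 / real l\<bar> powr p) =
    measure_pmf.expectation (pmf_of_set (P n))
      (\<lambda>\<sigma>. \<bar>real (num_cycles n l \<sigma>) / real n powr (real l / real (Max A)) - 1 / real l\<bar> powr p)) F"
    by (rule eventually_F)
      (simp add: integral_pmf_of_set finite_perms_with_lengths avg_def X_def scale_def)
  then show ?thesis
    using avg_abs_powr_tendsto[OF assms(3,4)] by (rule Lim_transform_eventually[rotated])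
qed

end
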